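(* Let $F$ be Thompson's group with standard generators $x_0,x_1$. Suppose we are given a convergent sequence of marked groups $\big((G_n,(x_0,x_1,g_{n,1},\ldots,g_{n,s}))\big)_{n<\omega}$, where $G_n=F$ and $g_{n,1},\ldots,g_{n,s}\in F$ for $n\in\mathbb{N}$, and denote by $\mathbb{G}$ its limit. Then $\mathbb{G}\neq F\ast G$ for any non-trivial group $G$; that is, $\mathbb{G}$ is not the free product of its subgroup $F=\langle x_0,x_1\rangle$ (generated by the first two marking elements) with a non-trivial group $G$.
   Context: Thompson's group $F$ is the group, under composition, of all strictly increasing continuous piecewise-linear functions from $[0,1]$ onto itself which are differentiable except at finitely many dyadic rationals and all of whose slopes are integer powers of $2$. It is generated by $x_0,x_1$, where $x_0(t)=t/2$ on $[0,\frac12]$, $t-\frac14$ on $[\frac12,\frac34]$, $2t-1$ on $[\frac34,1]$; and $x_1(t)=t$ on $[0,\frac12]$, $\frac t2+\frac14$ on $[\frac12,\frac34]$, $t-\frac18$ on $[\frac34,\frac78]$, $2t-1$ on $[\frac78,1]$. A marked group $(G,S)$ is a group $G$ with a finite ordered tuple of generators $S=(s_1,\ldots,s_m)$. On the set $\mathcal{G}_m$ of groups marked by $m$ generators (up to isomorphism of marked groups) two marked groups are at distance at most $e^{-R}$ if they have exactly the same relations of length at most $R$. Convergence and limits are with respect to this metric. In the limit $\mathbb{G}$ of a sequence as in the claim, the first two marking elements (limits of the constant sequences $x_0$ and $x_1$, again denoted $x_0,x_1$) generate a copy of $F$. *)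

theory Defs
  imports "HOL-Analysis.Analysis" "HOL-Algebra.Bij" "HOL-Algebra.Elementary_Groups"
begin

section \<open>Thompson's group F\<close>

text \<open>
  The carrier sits inside the library's group \<open>BijGroup {0..1}\<close>, so its elements are extensional
  (equal to \<^const>\<open>undefined\<close> outside the unit interval) and the product of \<open>f\<close> and \<open>g\<close> is
  \<open>t \<mapsto> f (g t)\<close>.  The points of non-differentiability all lie in the finite set \<open>P\<close>, and between
  two neighbouring points of \<open>P\<close> the function is affine with slope a power of 2.  The library's
  \<^const>\<open>dyadics\<close> contains only the nonnegative dyadic rationals, which is enough on \<open>[0,1]\<close>.
\<close>

definition pl_dyadic :: "(real \<Rightarrow> real) \<Rightarrow> bool"
  where "pl_dyadic f \<longleftrightarrow>
    (\<exists>P. finite P \<and> P \<subseteq> dyadics \<and>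
      (\<forall>a\<in>{0..1}. \<forall>b\<in>{0..1}. {a<..<b} \<inter> P = {} \<longrightarrow>
        (\<exists>(k::int) c. \<forall>t\<in>{a..b}. f t = 2 powi k * t + c)))"

definition thompson_F :: "(real \<Rightarrow> real) monoid"
  where "thompson_F = (BijGroup {0..1})
    \<lparr>carrier := {f \<in> Bij {0..1}. strict_mono_on {0..1} f \<and> continuous_on {0..1} f \<and> pl_dyadic f}\<rparr>"

definition thompson_x0 :: "real \<Rightarrow> real"
  where "thompson_x0 = (\<lambda>t\<in>{0..1}.
    if t \<le> 1/2 then t/2 else if t \<le> 3/4 then t - 1/4 else 2*t - 1)"

definition thompson_x1 :: "real \<Rightarrow> real"
  where "thompson_x1 = (\<lambda>t\<in>{0..1}.
    if t \<le> 1/2 then t else if t \<le> 3/4 then t/2 + 1/4 else if t \<le> 7/8 then t - 1/8 else 2*t - 1)"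


section \<open>Marked groups\<close>

definition marked_group :: "('a, 'm) monoid_scheme \<Rightarrow> 'a list \<Rightarrow> bool"
  where "marked_group G S \<longleftrightarrow> group G \<and> set S \<subseteq> carrier G \<and> generate G (set S) = carrier G"

text \<open>
  Words in the generators and their inverses: the letter \<open>(i, True)\<close> stands for the generator
  number \<open>i\<close> (counting from 0), the letter \<open>(i, False)\<close> for its inverse.
\<close>

fun word_value :: "('a, 'm) monoid_scheme \<Rightarrow> 'a list \<Rightarrow> (nat \<times> bool) list \<Rightarrow> 'a"
  where
    "word_value G S [] = \<one>\<^bsub>G\<^esub>"
  | "word_value G S ((i, e) # w) = (if e then S ! i else inv\<^bsub>G\<^esub> (S ! i)) \<otimes>\<^bsub>G\<^esub> word_value G S w"

definition relations_upto :: "('a, 'm) monoid_scheme \<Rightarrow> 'a list \<Rightarrow> nat \<Rightarrow> (nat \<times> bool) list set"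
  where "relations_upto G S R =
    {w. length w \<le> R \<and> fst ` set w \<subseteq> {..<length S} \<and> word_value G S w = \<one>\<^bsub>G\<^esub>}"

text \<open>
  The infimum is over a nonempty set (\<open>R = 0\<close> always qualifies); it is 0 iff the two marked
  groups have the same relations, i.e. are isomorphic as marked groups.
\<close>

definition marked_dist ::
  "('a, 'm) monoid_scheme \<Rightarrow> 'a list \<Rightarrow> ('b, 'n) monoid_scheme \<Rightarrow> 'b list \<Rightarrow> real"
  where "marked_dist G S H T =
    (INF R \<in> {R. relations_upto G S R = relations_upto H T R}. exp (- real R))"


section \<open>Free products\<close>

text \<open>
  The free product of \<open>A\<close> and \<open>B\<close> is the set of reduced words, whose letters are nontrivial
  elements taken alternately from \<open>A\<close> and \<open>B\<close>; the product is concatenation followed by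
  reduction.  \<open>fp_cons A B x w\<close> multiplies a reduced word \<open>w\<close> by a letter \<open>x\<close> on the left.
\<close>

fun fp_letter :: "('a, 'm) monoid_scheme \<Rightarrow> ('b, 'n) monoid_scheme \<Rightarrow> 'a + 'b \<Rightarrow> bool"
  where
    "fp_letter A B (Inl a) \<longleftrightarrow> a \<in> carrier A \<and> a \<noteq> \<one>\<^bsub>A\<^esub>"
  | "fp_letter A B (Inr b) \<longleftrightarrow> b \<in> carrier B \<and> b \<noteq> \<one>\<^bsub>B\<^esub>"

definition fp_reduced :: "('a, 'm) monoid_scheme \<Rightarrow> ('b, 'n) monoid_scheme \<Rightarrow> ('a + 'b) list \<Rightarrow> bool"
  where "fp_reduced A B w \<longleftrightarrow>
    (\<forall>x\<in>set w. fp_letter A B x) \<and> successively (\<lambda>x y. isl x \<noteq> isl y) w"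

fun fp_cons ::
  "('a, 'm) monoid_scheme \<Rightarrow> ('b, 'n) monoid_scheme \<Rightarrow> 'a + 'b \<Rightarrow> ('a + 'b) list \<Rightarrow> ('a + 'b) list"
  where
    "fp_cons A B (Inl a) (Inl a' # w) =
       (if a \<otimes>\<^bsub>A\<^esub> a' = \<one>\<^bsub>A\<^esub> then w else Inl (a \<otimes>\<^bsub>A\<^esub> a') # w)"
  | "fp_cons A B (Inr b) (Inr b' # w) =
       (if b \<otimes>\<^bsub>B\<^esub> b' = \<one>\<^bsub>B\<^esub> then w else Inr (b \<otimes>\<^bsub>B\<^esub> b') # w)"
  | "fp_cons A B (Inl a) w = (if a = \<one>\<^bsub>A\<^esub> then w else Inl a # w)"
  | "fp_cons A B (Inr b) w = (if b = \<one>\<^bsub>B\<^esub> then w else Inr b # w)"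

definition free_product ::
  "('a, 'm) monoid_scheme \<Rightarrow> ('b, 'n) monoid_scheme \<Rightarrow> ('a + 'b) list monoid"
  where "free_product A B =
    \<lparr>carrier = {w. fp_reduced A B w}, mult = foldr (fp_cons A B), one = []\<rparr>"

definition fp_inl :: "('a, 'm) monoid_scheme \<Rightarrow> 'a \<Rightarrow> ('a + 'b) list"
  where "fp_inl A a = (if a = \<one>\<^bsub>A\<^esub> then [] else [Inl a])"

definition fp_inr :: "('b, 'n) monoid_scheme \<Rightarrow> 'b \<Rightarrow> ('a + 'b) list"
  where "fp_inr B b = (if b = \<one>\<^bsub>B\<^esub> then [] else [Inr b])"

context
  fixes A :: "('a, 'm) monoid_scheme" and B :: "('b, 'n) monoid_scheme"
  assumes A: "group A" and B: "group B"
begin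

interpretation A: group A by (rule A)
interpretation B: group B by (rule B)

lemma fp_reduced_Nil: "fp_reduced A B []"
  by (simp add: fp_reduced_def)

lemma fp_reduced_Cons:
  "fp_reduced A B (x # w) \<longleftrightarrow>
    fp_letter A B x \<and> (w = [] \<or> isl x \<noteq> isl (hd w)) \<and> fp_reduced A B w"
  by (auto simp: fp_reduced_def successively_Cons)

lemma fp_cons_reduced:
  assumes "fp_letter A B x" "fp_reduced A B w"
  shows "fp_reduced A B (fp_cons A B x w)"
  using assms
  by (cases "(A, B, x, w)" rule: fp_cons.cases) (auto simp: fp_reduced_Cons fp_reduced_Nil)

lemma fp_cons_Cons_eq:
  assumes "fp_reduced A B (x # w)"
  shows "fp_cons A B x w = x # w"
  using assms
  by (cases "(A, B, x, w)" rule: fp_cons.cases) (auto simp: fp_reduced_Cons fp_reduced_Nil)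

lemma fp_cons_Inl_Inl:
  assumes a: "a \<in> carrier A" "a' \<in> carrier A" and w: "fp_reduced A B w"
  shows "fp_cons A B (Inl (a \<otimes>\<^bsub>A\<^esub> a')) w = fp_cons A B (Inl a) (fp_cons A B (Inl a') w)"
proof (cases "\<exists>c v. w = Inl c # v")
  case True
  then obtain c v where [simp]: "w = Inl c # v" by blast
  have c: "c \<in> carrier A" and v: "v = [] \<or> (\<exists>d u. v = Inr d # u)"
    using w by (cases v; cases "hd v"; auto simp: fp_reduced_Cons)+
  have "a \<otimes>\<^bsub>A\<^esub> a' \<otimes>\<^bsub>A\<^esub> c = a" if "a' \<otimes>\<^bsub>A\<^esub> c = \<one>\<^bsub>A\<^esub>"
    using a c that by (simp add: A.m_assoc)
  with v a c show ?thesis by (auto simp: A.m_assoc)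
next
  case False
  then have "w = [] \<or> (\<exists>d u. w = Inr d # u)"
    by (metis list.exhaust old.sum.exhaust)
  with a show ?thesis by auto
qed

lemma fp_cons_Inr_Inr:
  assumes b: "b \<in> carrier B" "b' \<in> carrier B" and w: "fp_reduced A B w"
  shows "fp_cons A B (Inr (b \<otimes>\<^bsub>B\<^esub> b')) w = fp_cons A B (Inr b) (fp_cons A B (Inr b') w)"
proof (cases "\<exists>c v. w = Inr c # v")
  case True
  then obtain c v where [simp]: "w = Inr c # v" by blast
  have c: "c \<in> carrier B" and v: "v = [] \<or> (\<exists>d u. v = Inl d # u)"
    using w by (cases v; cases "hd v"; auto simp: fp_reduced_Cons)+
  have "b \<otimes>\<^bsub>B\<^esub> b' \<otimes>\<^bsub>B\<^esub> c = b" if "b' \<otimes>\<^bsub>B\<^esub> c = \<one>\<^bsub>B\<^esub>"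
    using b c that by (simp add: B.m_assoc)
  with v b c show ?thesis by (auto simp: B.m_assoc)
next
  case False
  then have "w = [] \<or> (\<exists>d u. w = Inl d # u)"
    by (metis list.exhaust old.sum.exhaust)
  with b show ?thesis by auto
qed

lemma fp_cons_one:
  assumes "fp_reduced A B w"
  shows "fp_cons A B (Inl \<one>\<^bsub>A\<^esub>) w = w" "fp_cons A B (Inr \<one>\<^bsub>B\<^esub>) w = w"
proof -
  show "fp_cons A B (Inl \<one>\<^bsub>A\<^esub>) w = w"
    using assms
    by (cases "(A, B, Inl \<one>\<^bsub>A\<^esub> :: 'a + 'b, w)" rule: fp_cons.cases) (auto simp: fp_reduced_Cons)
  show "fp_cons A B (Inr \<one>\<^bsub>B\<^esub>) w = w"
    using assms
    by (cases "(A, B, Inr \<one>\<^bsub>B\<^esub> :: 'a + 'b, w)" rule: fp_cons.cases) (auto simp: fp_reduced_Cons)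
qed

lemma foldr_fp_cons_reduced:
  assumes "fp_reduced A B u" "fp_reduced A B v"
  shows "fp_reduced A B (foldr (fp_cons A B) u v)"
  using assms by (induction u) (auto simp: fp_reduced_Cons intro: fp_cons_reduced)

lemma foldr_fp_cons_Nil:
  "fp_reduced A B u \<Longrightarrow> foldr (fp_cons A B) u [] = u"
  by (induction u) (auto simp: fp_reduced_Cons fp_cons_Cons_eq)

lemma foldr_fp_cons_fp_cons:
  assumes x: "fp_letter A B x" and u: "fp_reduced A B u" and v: "fp_reduced A B v"
  shows "foldr (fp_cons A B) (fp_cons A B x u) v = fp_cons A B x (foldr (fp_cons A B) u v)"
proof (cases "(A, B, x, u)" rule: fp_cons.cases)
  case (1 A' B' a a' w)
  then have eq: "x = Inl a" "u = Inl a' # w" by simp_all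
  with u v have "fp_reduced A B (foldr (fp_cons A B) w v)"
    by (simp add: fp_reduced_Cons foldr_fp_cons_reduced)
  with eq x u show ?thesis
    using fp_cons_Inl_Inl[of a a' "foldr (fp_cons A B) w v"]
    by (auto simp: fp_reduced_Cons fp_cons_one)
next
  case (2 A' B' b b' w)
  then have eq: "x = Inr b" "u = Inr b' # w" by simp_all
  with u v have "fp_reduced A B (foldr (fp_cons A B) w v)"
    by (simp add: fp_reduced_Cons foldr_fp_cons_reduced)
  with eq x u show ?thesis
    using fp_cons_Inr_Inr[of b b' "foldr (fp_cons A B) w v"]
    by (auto simp: fp_reduced_Cons fp_cons_one)
qed (use x in auto)

lemma foldr_fp_cons_assoc:
  assumes "fp_reduced A B u" "fp_reduced A B v" "fp_reduced A B w"
  shows "foldr (fp_cons A B) (foldr (fp_cons A B) u v) w =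
    foldr (fp_cons A B) u (foldr (fp_cons A B) v w)"
  using assms
  by (induction u) (auto simp: fp_reduced_Cons foldr_fp_cons_fp_cons foldr_fp_cons_reduced)

lemma fp_letter_inverse:
  assumes "fp_letter A B x"
  obtains y where "fp_letter A B y" "fp_cons A B y [x] = []"
proof (cases x)
  case (Inl a)
  with assms show ?thesis by (intro that[of "Inl (inv\<^bsub>A\<^esub> a)"]) auto
next
  case (Inr b)
  with assms show ?thesis by (intro that[of "Inr (inv\<^bsub>B\<^esub> b)"]) auto
qed

lemma fp_left_inverse:
  "fp_reduced A B u \<Longrightarrow> \<exists>v. fp_reduced A B v \<and> foldr (fp_cons A B) v u = []"
proof (induction u)
  case Nil
  show ?case by (intro exI[of _ "[]"]) (simp add: fp_reduced_Nil)
next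
  case (Cons x u)
  then have x: "fp_letter A B x" and u: "fp_reduced A B u" by (auto simp: fp_reduced_Cons)
  obtain v where v: "fp_reduced A B v" "foldr (fp_cons A B) v u = []"
    using Cons.IH u by blast
  obtain y where y: "fp_letter A B y" "fp_cons A B y [x] = []"
    using fp_letter_inverse x by blast
  have yr: "fp_reduced A B [y]" using y by (simp add: fp_reduced_Cons fp_reduced_Nil)
  have xr: "fp_reduced A B [x]" using x by (simp add: fp_reduced_Cons fp_reduced_Nil)
  have "fp_cons A B y (x # u) = fp_cons A B y (fp_cons A B x u)"
    using Cons.prems by (simp add: fp_cons_Cons_eq)
  also have "\<dots> = foldr (fp_cons A B) (fp_cons A B y [x]) u"
    using foldr_fp_cons_fp_cons[OF y(1) xr u] by simp
  finally have yxu: "fp_cons A B y (x # u) = u" using y by simp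
  have "foldr (fp_cons A B) (foldr (fp_cons A B) v [y]) (x # u) = []"
    using foldr_fp_cons_assoc[OF v(1) yr Cons.prems] yxu v(2) by simp
  with foldr_fp_cons_reduced[OF v(1) yr] show ?case by blast
qed

theorem group_free_product: "group (free_product A B)"
  by (rule groupI)
    (auto simp: free_product_def fp_reduced_Nil foldr_fp_cons_reduced foldr_fp_cons_assoc
      fp_left_inverse)

lemma fp_inl_hom: "fp_inl A \<in> hom A (free_product A B)"
  by (auto simp: hom_def fp_inl_def free_product_def fp_reduced_Cons fp_reduced_Nil)

lemma fp_inr_hom: "fp_inr B \<in> hom B (free_product A B)"
  by (auto simp: hom_def fp_inr_def free_product_def fp_reduced_Cons fp_reduced_Nil)

end

end

theory Submission
  imports Defs
begin

text \<open>
  Let \<open>h, k \<in> F\<close> be supported in \<open>[p,1]\<close> and \<open>[0,p]\<close>, respectively.  For every \<open>y \<in> F\<close> either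
  \<open>y p \<le> p\<close>, and then \<open>y k y\<^sup>-\<^sup>1\<close> is supported in \<open>[0,p]\<close> and commutes with \<open>h\<close>, or \<open>y p \<ge> p\<close>, and
  then \<open>y h y\<^sup>-\<^sup>1\<close> is supported in \<open>[p,1]\<close> and commutes with \<open>k\<close>.  So one of the commutators
  \<open>[h, y k y\<^sup>-\<^sup>1]\<close> and \<open>[k, y h y\<^sup>-\<^sup>1]\<close> is trivial, and the two always commute.  This mixed identity
  passes to the limit, but it fails in \<open>\<langle>x\<^sub>0, x\<^sub>1\<rangle> * G\<close> for every nontrivial \<open>y \<in> G\<close>, since the two
  products of the commutators are reduced words with different first letters \<open>h\<close> and \<open>k\<close>.
\<close>

section \<open>Words in marked groups\<close>

definition word_inv :: "(nat \<times> bool) list \<Rightarrow> (nat \<times> bool) list"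
  where "word_inv w = rev (map (\<lambda>(i, e). (i, \<not> e)) w)"

definition word_comm :: "(nat \<times> bool) list \<Rightarrow> (nat \<times> bool) list \<Rightarrow> (nat \<times> bool) list"
  where "word_comm u v = u @ v @ word_inv u @ word_inv v"

lemma fst_set_word_inv [simp]: "fst ` set (word_inv w) = fst ` set w"
  by (force simp: word_inv_def)

lemma fst_set_word_comm [simp]: "fst ` set (word_comm u v) = fst ` set u \<union> fst ` set v"
  by (auto simp: word_comm_def image_Un)

definition comm :: "('a, 'm) monoid_scheme \<Rightarrow> 'a \<Rightarrow> 'a \<Rightarrow> 'a"
  where "comm G x y = x \<otimes>\<^bsub>G\<^esub> y \<otimes>\<^bsub>G\<^esub> inv\<^bsub>G\<^esub> x \<otimes>\<^bsub>G\<^esub> inv\<^bsub>G\<^esub> y"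

lemma (in group) comm_closed [simp]:
  "x \<in> carrier G \<Longrightarrow> y \<in> carrier G \<Longrightarrow> comm G x y \<in> carrier G"
  by (simp add: comm_def)

lemma (in group) comm_eq_one:
  assumes "x \<in> carrier G" "y \<in> carrier G" "x \<otimes> y = y \<otimes> x"
  shows "comm G x y = \<one>"
  using assms by (simp add: comm_def m_assoc flip: inv_mult_group)

definition mixed_word :: "(nat \<times> bool) list \<Rightarrow> (nat \<times> bool) list \<Rightarrow> (nat \<times> bool) list \<Rightarrow> (nat \<times> bool) list"
  where "mixed_word u v w = word_comm u (w @ v @ word_inv w) @ word_comm v (w @ u @ word_inv w)"

text \<open>Interchanging \<open>h\<close> and \<open>k\<close> interchanges the two factors. Hence
  the equation \<open>mixed_comm G h k y = mixed_comm G k h y\<close> says that the two commutators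
  commute, which turns a disjunction of two relations into one equation between words.\<close>

definition mixed_comm :: "('a, 'm) monoid_scheme \<Rightarrow> 'a \<Rightarrow> 'a \<Rightarrow> 'a \<Rightarrow> 'a"
  where "mixed_comm G h k y =
    comm G h (y \<otimes>\<^bsub>G\<^esub> k \<otimes>\<^bsub>G\<^esub> inv\<^bsub>G\<^esub> y) \<otimes>\<^bsub>G\<^esub> comm G k (y \<otimes>\<^bsub>G\<^esub> h \<otimes>\<^bsub>G\<^esub> inv\<^bsub>G\<^esub> y)"

lemma fst_set_mixed_word [simp]:
  "fst ` set (mixed_word u v w) = fst ` set u \<union> fst ` set v \<union> fst ` set w"
  by (auto simp: mixed_word_def image_Un)

lemma (in group) mixed_comm_closed [simp]:
  "h \<in> carrier G \<Longrightarrow> k \<in> carrier G \<Longrightarrow> y \<in> carrier G \<Longrightarrow> mixed_comm G h k y \<in> carrier G"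
  by (simp add: mixed_comm_def)

lemma (in group_hom) hom_mixed_comm:
  assumes "x \<in> carrier G" "y \<in> carrier G" "z \<in> carrier G"
  shows "h (mixed_comm G x y z) = mixed_comm H (h x) (h y) (h z)"
  using assms by (simp add: mixed_comm_def comm_def)

context
  fixes G :: "('a, 'm) monoid_scheme" and S :: "'a list"
  assumes G: "group G" and S: "set S \<subseteq> carrier G"
begin

interpretation group G by (rule G)

lemma word_value_closed [simp]:
  "fst ` set w \<subseteq> {..<length S} \<Longrightarrow> word_value G S w \<in> carrier G"
  using S by (induction w) (auto simp: subset_iff)

lemma word_value_append:
  assumes "fst ` set u \<subseteq> {..<length S}" "fst ` set v \<subseteq> {..<length S}"
  shows "word_value G S (u @ v) = word_value G S u \<otimes>\<^bsub>G\<^esub> word_value G S v"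
  using assms(1)
proof (induction u)
  case Nil
  with assms show ?case by simp
next
  case (Cons x u)
  obtain i e where x: "x = (i, e)" by fastforce
  with Cons.prems have "S ! i \<in> carrier G" using S by auto
  with Cons x assms(2) show ?case by (auto simp: m_assoc)
qed

lemma word_value_word_inv:
  assumes "fst ` set w \<subseteq> {..<length S}"
  shows "word_value G S (word_inv w) = inv\<^bsub>G\<^esub> word_value G S w"
  using assms
proof (induction w)
  case Nil
  show ?case by (simp add: word_inv_def)
next
  case (Cons x w)
  obtain i e where x: "x = (i, e)" by fastforce
  with Cons.prems have i: "i < length S" "S ! i \<in> carrier G" using S by auto
  have "word_value G S (word_inv (x # w)) = word_value G S (word_inv w @ [(i, \<not> e)])"
    by (simp add: x word_inv_def)
  also have "\<dots> = word_value G S (word_inv w) \<otimes>\<^bsub>G\<^esub> word_value G S [(i, \<not> e)]"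
    using Cons.prems i by (intro word_value_append) auto
  finally show ?case using Cons i by (auto simp: x inv_mult_group)
qed

lemma word_value_word_comm:
  assumes "fst ` set u \<subseteq> {..<length S}" "fst ` set v \<subseteq> {..<length S}"
  shows "word_value G S (word_comm u v) = comm G (word_value G S u) (word_value G S v)"
  using assms
  by (simp add: word_comm_def comm_def word_value_append word_value_word_inv m_assoc image_Un)

lemma word_value_mixed_word:
  assumes "fst ` set u \<subseteq> {..<length S}" "fst ` set v \<subseteq> {..<length S}" "fst ` set w \<subseteq> {..<length S}"
  shows "word_value G S (mixed_word u v w) =
    mixed_comm G (word_value G S u) (word_value G S v) (word_value G S w)"
  using assms
  by (simp add: mixed_word_def mixed_comm_def word_value_append word_value_word_inv
      word_value_word_comm m_assoc image_Un)

text \<open>Allows an arbitrary element of a limit to be tested in the approximating groups: the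
  word that spells it there has a value in each of them as well.\<close>

lemma generate_word:
  assumes "x \<in> generate G (set S)"
  shows "\<exists>w. fst ` set w \<subseteq> {..<length S} \<and> word_value G S w = x"
  using assms
proof induction
  case one
  show ?case by (intro exI[of _ "[]"]) simp
next
  case (incl h)
  then obtain i where "i < length S" "h = S ! i" by (auto simp: in_set_conv_nth)
  moreover from incl S have "h \<in> carrier G" by blast
  ultimately show ?case by (intro exI[of _ "[(i, True)]"]) auto
next
  case (inv h)
  then obtain i where "i < length S" "h = S ! i" by (auto simp: in_set_conv_nth)
  moreover from inv S have "h \<in> carrier G" by blast
  ultimately show ?case by (intro exI[of _ "[(i, False)]"]) auto
next
  case (eng x y)
  then obtain u v where
    "fst ` set u \<subseteq> {..<length S} \<and> word_value G S u = x"
    "fst ` set v \<subseteq> {..<length S} \<and> word_value G S v = y" by blast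
  then show ?case by (intro exI[of _ "u @ v"]) (auto simp: word_value_append)
qed

text \<open>The metric on marked groups compares only words of value one, so an equation between two
  words has to be brought into this form.\<close>

lemma word_value_eq_iff:
  assumes "fst ` set u \<subseteq> {..<length S}" "fst ` set v \<subseteq> {..<length S}"
  shows "word_value G S u = word_value G S v \<longleftrightarrow> word_value G S (u @ word_inv v) = \<one>\<^bsub>G\<^esub>"
proof -
  have "word_value G S (u @ word_inv v) = word_value G S u \<otimes>\<^bsub>G\<^esub> inv\<^bsub>G\<^esub> word_value G S v"
    using assms by (simp add: word_value_append word_value_word_inv)
  with assms show ?thesis
    by (metis inv_closed inv_equality inv_inv r_inv word_value_closed)
qed

end

section \<open>Passing relations to the limit of marked groups\<close>

lemma marked_dist_tendsto_relation:
  assumes lim: "(\<lambda>n. marked_dist H (T n) L S) \<longlonglongrightarrow> 0"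
    and len: "\<And>n. length (T n) = length S"
    and w: "fst ` set w \<subseteq> {..<length S}"
  shows "\<forall>\<^sub>F n in sequentially. word_value H (T n) w = \<one>\<^bsub>H\<^esub> \<longleftrightarrow> word_value L S w = \<one>\<^bsub>L\<^esub>"
proof -
  have "\<forall>\<^sub>F n in sequentially. marked_dist H (T n) L S < exp (- real (length w))"
    using order_tendstoD(2)[OF lim] by simp
  then show ?thesis
  proof eventually_elim
    case (elim n)
    \<comment> \<open>The only word of length 0 is the empty one, so radius 0 always qualifies. The
      infimum is therefore over a nonempty set, and being below
      \<open>exp (- real (length w))\<close> it is undercut by some member whose radius
      \<open>R\<close> exceeds the length of \<open>w\<close>.\<close>
    have "relations_upto H (T n) 0 = relations_upto L S 0"
      by (auto simp: relations_upto_def)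
    then have "{R. relations_upto H (T n) R = relations_upto L S R} \<noteq> {}" by blast
    with elim obtain R where R: "relations_upto H (T n) R = relations_upto L S R"
      and "exp (- real R) < exp (- real (length w))"
      unfolding marked_dist_def by (auto dest!: cInf_lessD[rotated])
    then have "length w \<le> R" by simp
    with R w len[of n] show ?case by (auto simp: relations_upto_def set_eq_iff)
  qed
qed

lemma marked_dist_tendsto_word_eq:
  assumes lim: "(\<lambda>n. marked_dist H (T n) L S) \<longlonglongrightarrow> 0"
    and len: "\<And>n. length (T n) = length S"
    and H: "group H" "\<And>n. set (T n) \<subseteq> carrier H" and L: "group L" "set S \<subseteq> carrier L"
    and u: "fst ` set u \<subseteq> {..<length S}" and v: "fst ` set v \<subseteq> {..<length S}"
  shows "\<forall>\<^sub>F n in sequentially.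
    word_value H (T n) u = word_value H (T n) v \<longleftrightarrow> word_value L S u = word_value L S v"
proof -
  have "fst ` set (u @ word_inv v) \<subseteq> {..<length S}"
    using u v by (simp add: image_Un)
  from marked_dist_tendsto_relation[OF lim len this] show ?thesis
    using word_value_eq_iff[OF H, of u _ v] word_value_eq_iff[OF L u v] u v
    by (simp add: len)
qed

section \<open>Dyadic rationals\<close>

text \<open>Unlike \<^const>\<open>dyadics\<close>, this set contains the negative dyadic rationals.\<close>

definition dyadic_rats :: "real set"
  where "dyadic_rats = {x. \<exists>n::nat. x * 2 ^ n \<in> \<int>}"

lemma dyadics_iff_dyadic_rats: "x \<in> dyadics \<longleftrightarrow> 0 \<le> x \<and> x \<in> dyadic_rats"
proof
  assume "x \<in> dyadics"
  then obtain k m where x: "x = real m / 2 ^ k" by (auto simp: dyadics_def)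
  then have "x * 2 ^ k \<in> \<int>" by simp
  then have "x \<in> dyadic_rats" unfolding dyadic_rats_def by blast
  with x show "0 \<le> x \<and> x \<in> dyadic_rats" by simp
next
  assume x: "0 \<le> x \<and> x \<in> dyadic_rats"
  then obtain n where n: "x * 2 ^ n \<in> \<int>" by (auto simp: dyadic_rats_def)
  then obtain i where i: "x * 2 ^ n = of_int i" by (auto elim: Ints_cases)
  have "0 \<le> x * 2 ^ n" using x by simp
  with i have "0 \<le> i" by simp
  then have "x * 2 ^ n = real (nat i)" using i by simp
  then have "x = of_nat (nat i) / 2 ^ n" by (simp add: field_simps)
  then show "x \<in> dyadics" unfolding dyadics_def by blast
qed

lemma dyadic_rats_0 [simp]: "0 \<in> dyadic_rats"
  by (simp add: dyadic_rats_def)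

lemma dyadic_rats_add:
  assumes "x \<in> dyadic_rats" "y \<in> dyadic_rats"
  shows "x + y \<in> dyadic_rats"
proof -
  obtain n m where "x * 2 ^ n \<in> \<int>" "y * 2 ^ m \<in> \<int>"
    using assms by (auto simp: dyadic_rats_def)
  then have "x * 2 ^ n * 2 ^ m + y * 2 ^ m * 2 ^ n \<in> \<int>" by (simp add: Ints_mult)
  then have "(x + y) * 2 ^ (n + m) \<in> \<int>" by (simp add: algebra_simps power_add)
  then show ?thesis by (auto simp: dyadic_rats_def)
qed

lemma dyadic_rats_minus: "x \<in> dyadic_rats \<Longrightarrow> - x \<in> dyadic_rats"
  by (auto simp: dyadic_rats_def)

lemma dyadic_rats_diff: "x \<in> dyadic_rats \<Longrightarrow> y \<in> dyadic_rats \<Longrightarrow> x - y \<in> dyadic_rats"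
  using dyadic_rats_add[of x "- y"] dyadic_rats_minus by simp

lemma dyadic_rats_powi_mult:
  assumes "x \<in> dyadic_rats"
  shows "2 powi k * x \<in> dyadic_rats"
proof -
  obtain n where n: "x * 2 ^ n \<in> \<int>" using assms by (auto simp: dyadic_rats_def)
  show ?thesis
  proof (cases "k \<ge> 0")
    case True
    then have "2 powi k * x * 2 ^ n = 2 ^ nat k * (x * 2 ^ n)" by (simp add: power_int_def)
    also have "\<dots> \<in> \<int>" using n by (simp add: Ints_mult)
    finally show ?thesis by (auto simp: dyadic_rats_def)
  next
    case False
    then have "2 powi k * x * 2 ^ (n + nat (- k)) = x * 2 ^ n"
      by (simp add: power_int_def power_add field_simps)
    with n show ?thesis unfolding dyadic_rats_def by (metis mem_Collect_eq)
  qed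
qed

text \<open>The inverse of \<open>t\<close> to \<open>2 powi k * t + c\<close> is again affine with
  a power of 2 as slope and a dyadic offset, so one closure argument serves both directions.\<close>

lemma dyadic_rats_affine_iff:
  assumes "c \<in> dyadic_rats"
  shows "2 powi k * t + c \<in> dyadic_rats \<longleftrightarrow> t \<in> dyadic_rats"
proof
  assume "2 powi k * t + c \<in> dyadic_rats"
  then have "2 powi (- k) * (2 powi k * t + c - c) \<in> dyadic_rats"
    by (intro dyadic_rats_powi_mult dyadic_rats_diff assms)
  then show "t \<in> dyadic_rats" by (simp add: power_int_minus field_simps)
qed (intro dyadic_rats_add dyadic_rats_powi_mult assms)

section \<open>Thompson's group\<close>

lemma pl_dyadicI:
  assumes "finite P" "P \<subseteq> dyadics"
    and "\<And>a b. a \<in> {0..1} \<Longrightarrow> b \<in> {0..1} \<Longrightarrow> {a<..<b} \<inter> P = {} \<Longrightarrow>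
      \<exists>(k::int) c. \<forall>t\<in>{a..b}. f t = 2 powi k * t + c"
  shows "pl_dyadic f"
  unfolding pl_dyadic_def by (rule exI[of _ P]) (use assms in simp)

lemma carrier_thompson_F:
  "f \<in> carrier thompson_F \<longleftrightarrow>
    f \<in> Bij {0..1} \<and> strict_mono_on {0..1} f \<and> continuous_on {0..1} f \<and> pl_dyadic f"
  by (simp add: thompson_F_def)

lemma thompson_F_mem:
  assumes "f \<in> carrier thompson_F" "t \<in> {0..1}"
  shows "f t \<in> {0..1}"
  using assms by (auto simp: carrier_thompson_F dest!: Bij_imp_funcset)

lemma thompson_F_less_iff:
  assumes "f \<in> carrier thompson_F" "s \<in> {0..1}" "t \<in> {0..1}"
  shows "f s < f t \<longleftrightarrow> s < t"
  using assms by (metis carrier_thompson_F strict_mono_on_less)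

lemma thompson_F_le_iff:
  assumes "f \<in> carrier thompson_F" "s \<in> {0..1}" "t \<in> {0..1}"
  shows "f s \<le> f t \<longleftrightarrow> s \<le> t"
  using thompson_F_less_iff[OF assms(1,3,2)] by linarith

lemma thompson_F_image:
  assumes "f \<in> carrier thompson_F"
  shows "f ` {0..1} = {0..1}"
  using assms by (simp add: carrier_thompson_F Bij_def bij_betw_def)

section \<open>Dyadic points, composites and inverses in F\<close>

lemma thompson_F_0:
  assumes f: "f \<in> carrier thompson_F"
  shows "f 0 = 0"
proof -
  obtain t where t: "t \<in> {0..1}" "f t = 0"
    using thompson_F_image[OF f] by (metis atLeastAtMost_iff imageE order_refl zero_le_one)
  have "f 0 \<le> f t" using thompson_F_le_iff[OF f, of 0 t] t by simp
  with thompson_F_mem[OF f, of 0] t show ?thesis by simp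
qed

text \<open>The definition of \<open>pl_dyadic\<close> restricts the slopes but says nothing about
  the offsets. These are dyadic because \<open>f\<close> starts at 0 and consecutive pieces agree at
  a dyadic breakpoint; the induction runs over the number of breakpoints to the left of
  \<open>t\<close>.\<close>

lemma pl_dyadic_affine_at:
  assumes f0: "f 0 = 0"
    and P: "finite P" "P \<subseteq> dyadics"
    and pl: "\<And>a b. a \<in> {0..1} \<Longrightarrow> b \<in> {0..1} \<Longrightarrow> {a<..<b} \<inter> P = {} \<Longrightarrow>
        \<exists>(k::int) c. \<forall>t\<in>{a..b}. f t = 2 powi k * t + c"
    and t: "t \<in> {0..1}"
  shows "\<exists>(k::int) c. c \<in> dyadic_rats \<and> f t = 2 powi k * t + c"
  using t
proof (induction "card (P \<inter> {0<..<t})" arbitrary: t rule: less_induct)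
  case less
  show ?case
  proof (cases "P \<inter> {0<..<t} = {}")
    case True
    then obtain k c where kc: "\<forall>s\<in>{0..t}. f s = 2 powi (k::int) * s + c"
      using pl[of 0 t] less.prems by auto
    \<comment> \<open>Evaluation at 0 gives \<open>c = f 0 = 0\<close>.\<close>
    from bspec[OF kc, of 0] less.prems f0 have "c \<in> dyadic_rats" by simp
    with bspec[OF kc, of t] less.prems show ?thesis by auto
  next
    case False
    \<comment> \<open>The last breakpoint before \<open>t\<close>: fewer breakpoints lie to the left
      of \<open>p\<close>, and \<open>f\<close> is affine on the whole of \<open>{p..t}\<close>. The
      induction hypothesis makes \<open>f p\<close> dyadic, and with it the offset of the piece that
      starts at \<open>p\<close>.\<close>
    define p where "p = Max (P \<inter> {0<..<t})"
    have fin: "finite (P \<inter> {0<..<t})" using P by simp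
    have p: "p \<in> P" "0 < p" "p < t" using Max_in[OF fin False] by (auto simp: p_def)
    have gap: "{p<..<t} \<inter> P = {}"
      using Max_ge[OF fin] p unfolding p_def[symmetric] by force
    have "P \<inter> {0<..<p} \<subset> P \<inter> {0<..<t}" using p by auto
    then have "card (P \<inter> {0<..<p}) < card (P \<inter> {0<..<t})" by (simp add: fin psubset_card_mono)
    with less.hyps[of p] p less.prems obtain k' c' where
      fp: "c' \<in> dyadic_rats" "f p = 2 powi (k'::int) * p + c'" by auto
    have pD: "p \<in> dyadic_rats" using p P by (auto simp: dyadics_iff_dyadic_rats)
    obtain k c where kc: "\<forall>s\<in>{p..t}. f s = 2 powi (k::int) * s + c"
      using pl[of p t] gap p less.prems by auto
    have "c = f p - 2 powi k * p" using bspec[OF kc, of p] p by simp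
    then have "c \<in> dyadic_rats"
      using fp pD by (auto intro!: dyadic_rats_diff dyadic_rats_add dyadic_rats_powi_mult)
    with bspec[OF kc, of t] p show ?thesis by auto
  qed
qed

text \<open>Both directions matter: the new breakpoints of a composite are preimages of breakpoints,
  those of an inverse are images, and either kind has to be dyadic again.\<close>

lemma thompson_F_dyadics_iff:
  assumes f: "f \<in> carrier thompson_F" and t: "t \<in> {0..1}"
  shows "f t \<in> dyadics \<longleftrightarrow> t \<in> dyadics"
proof -
  obtain P where "finite P" "P \<subseteq> dyadics" "\<forall>a\<in>{0..1}. \<forall>b\<in>{0..1}. {a<..<b} \<inter> P = {} \<longrightarrow>
        (\<exists>(k::int) c. \<forall>t\<in>{a..b}. f t = 2 powi k * t + c)"
    using f by (auto simp: carrier_thompson_F pl_dyadic_def)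
  then obtain k c where "c \<in> dyadic_rats" "f t = 2 powi (k::int) * t + c"
    using pl_dyadic_affine_at[of f P, OF thompson_F_0[OF f]] t by metis
  then show ?thesis
    using thompson_F_mem[OF f t] t by (auto simp: dyadics_iff_dyadic_rats dyadic_rats_affine_iff)
qed

lemma pl_dyadic_compose:
  assumes f: "f \<in> carrier thompson_F" and g: "g \<in> carrier thompson_F"
  shows "pl_dyadic (compose {0..1} f g)"
proof -
  obtain P where P: "finite P" "P \<subseteq> dyadics" "\<And>a b. a \<in> {0..1} \<Longrightarrow> b \<in> {0..1} \<Longrightarrow>
      {a<..<b} \<inter> P = {} \<Longrightarrow> (\<exists>(k::int) c. \<forall>t\<in>{a..b}. f t = 2 powi k * t + c)"
    using f by (auto simp: carrier_thompson_F pl_dyadic_def)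
  obtain Q where Q: "finite Q" "Q \<subseteq> dyadics" "\<And>a b. a \<in> {0..1} \<Longrightarrow> b \<in> {0..1} \<Longrightarrow>
      {a<..<b} \<inter> Q = {} \<Longrightarrow> (\<exists>(k::int) c. \<forall>t\<in>{a..b}. g t = 2 powi k * t + c)"
    using g by (auto simp: carrier_thompson_F pl_dyadic_def)
  have inj: "inj_on g {0..1}" using g by (simp add: carrier_thompson_F Bij_def bij_betw_def)
  \<comment> \<open>A composite can break only where \<open>g\<close> breaks or where
    \<open>g\<close> hits a breakpoint of \<open>f\<close>.\<close>
  define R where "R = Q \<union> {t \<in> {0..1}. g t \<in> P}"
  have "{t \<in> {0..1}. g t \<in> P} = g -` P \<inter> {0..1}" by auto
  then have "finite R" using P Q finite_vimage_IntI[OF P(1) inj] by (simp add: R_def)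
  moreover have "R \<subseteq> dyadics"
    using P Q thompson_F_dyadics_iff[OF g] by (auto simp: R_def)
  moreover have "\<exists>(k::int) c. \<forall>t\<in>{a..b}. compose {0..1} f g t = 2 powi k * t + c"
    if a: "a \<in> {0..1}" and b: "b \<in> {0..1}" and ab: "{a<..<b} \<inter> R = {}" for a b
  proof -
    have "{a<..<b} \<inter> Q = {}" using ab by (auto simp: R_def)
    then obtain k c where kc: "\<And>t. t \<in> {a..b} \<Longrightarrow> g t = 2 powi (k::int) * t + c"
      using Q(3)[OF a b] by blast
    \<comment> \<open>A breakpoint of \<open>f\<close> strictly between \<open>g a\<close> and
      \<open>g b\<close> is \<open>g t\<close> for some \<open>t\<close> by surjectivity.
      Monotonicity puts \<open>t\<close> strictly between \<open>a\<close> and \<open>b\<close>,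
      where it would belong to \<open>R\<close>.\<close>
    have "{g a<..<g b} \<inter> P = {}"
    proof (rule ccontr)
      assume "{g a<..<g b} \<inter> P \<noteq> {}"
      then obtain p where p: "g a < p" "p < g b" "p \<in> P" by auto
      then have "p \<in> {0..1}" using thompson_F_mem[OF g a] thompson_F_mem[OF g b] by auto
      then obtain t where t: "t \<in> {0..1}" "p = g t" using thompson_F_image[OF g] by blast
      with p a b have "t \<in> {a<..<b}" by (simp add: thompson_F_less_iff[OF g])
      with ab p t show False by (auto simp: R_def)
    qed
    then obtain l d where ld: "\<And>t. t \<in> {g a..g b} \<Longrightarrow> f t = 2 powi (l::int) * t + d"
      using P(3) thompson_F_mem[OF g a] thompson_F_mem[OF g b] by blast
    have "compose {0..1} f g t = 2 powi (l + k) * t + (2 powi l * c + d)" if t: "t \<in> {a..b}" for t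
    proof -
      have "t \<in> {0..1}" using t a b by auto
      moreover from this have "g t \<in> {g a..g b}" using t a b by (simp add: thompson_F_le_iff[OF g])
      ultimately show ?thesis
        using ld kc[OF t] by (simp add: compose_def power_int_add algebra_simps)
    qed
    then show ?thesis by blast
  qed
  ultimately show ?thesis by (rule pl_dyadicI)
qed

lemma thompson_F_compose:
  assumes f: "f \<in> carrier thompson_F" and g: "g \<in> carrier thompson_F"
  shows "compose {0..1} f g \<in> carrier thompson_F"
proof -
  have "strict_mono_on {0..1} (compose {0..1} f g)"
    using f g by (auto intro!: strict_mono_onI
        simp: compose_def thompson_F_less_iff thompson_F_mem[simplified])
  moreover have "continuous_on {0..1} (f \<circ> g)"
    using f g by (intro continuous_on_compose) (auto simp: thompson_F_image, auto simp: carrier_thompson_F)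
  then have "continuous_on {0..1} (compose {0..1} f g)"
    by (rule continuous_on_eq) (simp add: compose_def)
  ultimately show ?thesis
    using f g pl_dyadic_compose[OF f g] by (simp add: carrier_thompson_F compose_Bij)
qed

lemma thompson_F_inverse:
  assumes f: "f \<in> carrier thompson_F"
  defines "g \<equiv> \<lambda>t\<in>{0..1}. inv_into {0..1} f t"
  shows "g \<in> carrier thompson_F"
proof -
  have fB: "f \<in> Bij {0..1}" using f by (simp add: carrier_thompson_F)
  then have gB: "g \<in> Bij {0..1}" unfolding g_def by (rule restrict_inv_into_Bij)
  have inj: "inj_on f {0..1}" using fB by (simp add: Bij_def bij_betw_def)
  have g_mem: "g t \<in> {0..1}" if "t \<in> {0..1}" for t
    using Bij_inv_into_mem[OF fB that] that by (simp add: g_def)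
  have fg: "f (g t) = t" if "t \<in> {0..1}" for t
    using that thompson_F_image[OF f] by (simp add: g_def f_inv_into_f)
  have gf: "g (f t) = t" if "t \<in> {0..1}" for t
    using that thompson_F_mem[OF f that] inj by (simp add: g_def)
  have mono: "g s < g t \<longleftrightarrow> s < t" if "s \<in> {0..1}" "t \<in> {0..1}" for s t
    using thompson_F_less_iff[OF f, of "g s" "g t"] that by (simp add: fg g_mem[simplified])
  \<comment> \<open>A continuous injection on a compact set has a continuous inverse on its
    image.\<close>
  have "continuous_on (f ` {0..1}) g"
    using f by (intro continuous_on_inv) (auto simp: carrier_thompson_F gf)
  then have cont: "continuous_on {0..1} g" by (simp add: thompson_F_image[OF f])
  obtain P where P: "finite P" "P \<subseteq> dyadics" "\<And>a b. a \<in> {0..1} \<Longrightarrow> b \<in> {0..1} \<Longrightarrow>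
      {a<..<b} \<inter> P = {} \<Longrightarrow> (\<exists>(k::int) c. \<forall>t\<in>{a..b}. f t = 2 powi k * t + c)"
    using f by (auto simp: carrier_thompson_F pl_dyadic_def)
  \<comment> \<open>The inverse breaks at the images of the breakpoints of \<open>f\<close>. The set
    \<open>P\<close> may contain points beyond 1, where nothing is known about \<open>f\<close>,
    hence the intersection.\<close>
  define R where "R = f ` (P \<inter> {0..1})"
  have "finite R" using P by (simp add: R_def)
  moreover have "R \<subseteq> dyadics" using P thompson_F_dyadics_iff[OF f] by (auto simp: R_def)
  moreover have "\<exists>(k::int) c. \<forall>t\<in>{a..b}. g t = 2 powi k * t + c"
    if a: "a \<in> {0..1}" and b: "b \<in> {0..1}" and ab: "{a<..<b} \<inter> R = {}" for a b
  proof -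
    have "{g a<..<g b} \<inter> P = {}"
    proof (rule ccontr)
      assume "{g a<..<g b} \<inter> P \<noteq> {}"
      then obtain p where p: "g a < p" "p < g b" "p \<in> P" by auto
      then have p01: "p \<in> {0..1}" using g_mem[OF a] g_mem[OF b] by auto
      have "f (g a) < f p" "f p < f (g b)"
        using p p01 g_mem[OF a] g_mem[OF b] by (simp_all add: thompson_F_less_iff[OF f])
      then have "f p \<in> {a<..<b}" using fg a b by simp
      with ab p p01 show False by (auto simp: R_def)
    qed
    then obtain k c where kc: "\<And>t. t \<in> {g a..g b} \<Longrightarrow> f t = 2 powi (k::int) * t + c"
      using P(3) g_mem[OF a] g_mem[OF b] by blast
    have "g t = 2 powi (- k) * t + (- (2 powi (- k) * c))" if t: "t \<in> {a..b}" for t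
    proof -
      have t01: "t \<in> {0..1}" using t a b by auto
      then have "g t \<in> {g a..g b}" using t mono[OF t01 a] mono[OF b t01] by (simp add: not_less[symmetric])
      from kc[OF this] have "t = 2 powi k * g t + c" using fg[OF t01] by simp
      then show ?thesis by (simp add: power_int_minus field_simps)
    qed
    then show ?thesis by blast
  qed
  ultimately have "pl_dyadic g" by (rule pl_dyadicI)
  with gB cont mono show ?thesis by (simp add: carrier_thompson_F strict_mono_on_def)
qed

lemma subgroup_thompson_F: "subgroup (carrier thompson_F) (BijGroup {0..1})"
proof (rule group.subgroupI[OF group_BijGroup])
  show sub: "carrier thompson_F \<subseteq> carrier (BijGroup {0..1})"
    by (auto simp: carrier_thompson_F BijGroup_def)
  have "\<exists>(k::int) c. \<forall>t\<in>{a..b}. (\<lambda>t\<in>{0..1}. t) t = 2 powi k * t + c"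
    if "a \<in> {0..1}" "b \<in> {0..1}" for a b :: real
    using that by (intro exI[of _ 0]) auto
  then have "pl_dyadic (\<lambda>t\<in>{0..1}. t)"
    by (intro pl_dyadicI[of "{}"]) auto
  then have "(\<lambda>t\<in>{0..1}. t) \<in> carrier thompson_F"
    using id_Bij[of "{0..1::real}"]
    by (auto simp: carrier_thompson_F strict_mono_on_def intro: continuous_on_eq[OF continuous_on_id])
  then show "carrier thompson_F \<noteq> {}" by blast
  fix f assume f: "f \<in> carrier thompson_F"
  then have fB: "f \<in> Bij {0..1}" by (simp add: carrier_thompson_F)
  have "inv\<^bsub>BijGroup {0..1}\<^esub> f = (\<lambda>t\<in>{0..1}. inv_into {0..1} f t)"
    by (rule inv_BijGroup[OF fB])
  with thompson_F_inverse[OF f] show "inv\<^bsub>BijGroup {0..1}\<^esub> f \<in> carrier thompson_F" by simp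
  fix g assume g: "g \<in> carrier thompson_F"
  with thompson_F_compose[OF f g] fB show "f \<otimes>\<^bsub>BijGroup {0..1}\<^esub> g \<in> carrier thompson_F"
    by (simp add: BijGroup_def carrier_thompson_F)
qed

lemma group_thompson_F: "group thompson_F"
  using subgroup.subgroup_is_group[OF subgroup_thompson_F group_BijGroup]
  by (simp add: thompson_F_def)

interpretation F: group thompson_F
  by (rule group_thompson_F)

section \<open>Supports and the mixed identity in F\<close>

lemma thompson_F_mult_apply:
  assumes "f \<in> carrier thompson_F" "g \<in> carrier thompson_F" "t \<in> {0..1}"
  shows "(f \<otimes>\<^bsub>thompson_F\<^esub> g) t = f (g t)"
  using assms by (simp add: thompson_F_def BijGroup_def compose_def)

lemma thompson_F_one_apply: "t \<in> {0..1} \<Longrightarrow> \<one>\<^bsub>thompson_F\<^esub> t = t"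
  by (simp add: thompson_F_def BijGroup_def)

lemma thompson_F_inv_apply:
  assumes "f \<in> carrier thompson_F" "t \<in> {0..1}"
  shows "(inv\<^bsub>thompson_F\<^esub> f) (f t) = t" "f ((inv\<^bsub>thompson_F\<^esub> f) t) = t"
  using assms thompson_F_mult_apply[of "inv\<^bsub>thompson_F\<^esub> f" f t]
    thompson_F_mult_apply[of f "inv\<^bsub>thompson_F\<^esub> f" t]
  by (simp_all add: thompson_F_one_apply)

lemma thompson_F_eqI:
  assumes "f \<in> carrier thompson_F" "g \<in> carrier thompson_F" "\<And>t. t \<in> {0..1} \<Longrightarrow> f t = g t"
  shows "f = g"
  using assms by (auto simp: carrier_thompson_F intro: extensionalityI[of _ "{0..1}"] Bij_imp_extensional)

text \<open>Both maps are increasing and fix \<open>p\<close>, so each of them preserves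
  \<open>{0..p}\<close> and \<open>{p..1}\<close>. On either of these intervals one of the two is
  the identity.\<close>

lemma thompson_F_disjoint_support_commute:
  assumes f: "f \<in> carrier thompson_F" and g: "g \<in> carrier thompson_F"
    and p: "p \<in> {0..1}"
    and f_fix: "\<And>t. t \<in> {0..p} \<Longrightarrow> f t = t" and g_fix: "\<And>t. t \<in> {p..1} \<Longrightarrow> g t = t"
  shows "f \<otimes>\<^bsub>thompson_F\<^esub> g = g \<otimes>\<^bsub>thompson_F\<^esub> f"
proof (rule thompson_F_eqI)
  fix t :: real assume t: "t \<in> {0..1}"
  have "f (g t) = g (f t)"
  proof (cases "t \<le> p")
    case True
    have "g t \<le> g p" using True t p thompson_F_le_iff[OF g] by simp
    then have "g t \<in> {0..p}" using g_fix[of p] p thompson_F_mem[OF g t] by simp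
    then show ?thesis using True t f_fix by simp
  next
    case False
    have "f p \<le> f t" using False t p thompson_F_le_iff[OF f] by simp
    then have "f t \<in> {p..1}" using f_fix[of p] p thompson_F_mem[OF f t] by simp
    then show ?thesis using False t g_fix by simp
  qed
  with f g t show "(f \<otimes>\<^bsub>thompson_F\<^esub> g) t = (g \<otimes>\<^bsub>thompson_F\<^esub> f) t"
    by (simp add: thompson_F_mult_apply)
qed (use f g in auto)

text \<open>The support of the conjugate is the image under \<open>y\<close> of the support of
  \<open>f\<close>.\<close>

lemma thompson_F_conjugate_fix:
  assumes "f \<in> carrier thompson_F" "y \<in> carrier thompson_F" "t \<in> {0..1}"
    and "f ((inv\<^bsub>thompson_F\<^esub> y) t) = (inv\<^bsub>thompson_F\<^esub> y) t"
  shows "(y \<otimes>\<^bsub>thompson_F\<^esub> f \<otimes>\<^bsub>thompson_F\<^esub> inv\<^bsub>thompson_F\<^esub> y) t = t"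
  using assms thompson_F_mem[of "inv\<^bsub>thompson_F\<^esub> y" t]
  by (simp add: thompson_F_mult_apply thompson_F_inv_apply)

lemma thompson_F_mixed_identity:
  assumes h: "h \<in> carrier thompson_F" and k: "k \<in> carrier thompson_F"
    and y: "y \<in> carrier thompson_F" and p: "p \<in> {0..1}"
    and h_fix: "\<And>t. t \<in> {0..p} \<Longrightarrow> h t = t" and k_fix: "\<And>t. t \<in> {p..1} \<Longrightarrow> k t = t"
  shows "mixed_comm thompson_F h k y = mixed_comm thompson_F k h y"
proof -
  let ?i = "inv\<^bsub>thompson_F\<^esub> y"
  define a b where "a = comm thompson_F h (y \<otimes>\<^bsub>thompson_F\<^esub> k \<otimes>\<^bsub>thompson_F\<^esub> ?i)"
    and "b = comm thompson_F k (y \<otimes>\<^bsub>thompson_F\<^esub> h \<otimes>\<^bsub>thompson_F\<^esub> ?i)"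
  note a_def = this(1) and b_def = this(2)
  have i: "?i \<in> carrier thompson_F" using y by simp
  have ab: "a \<in> carrier thompson_F" "b \<in> carrier thompson_F"
    using h k y by (simp_all add: a_def b_def)
  have "a = \<one>\<^bsub>thompson_F\<^esub> \<or> b = \<one>\<^bsub>thompson_F\<^esub>"
  \<comment> \<open>This is the distinction whether \<open>y p\<close> is at most \<open>p\<close>,
    stated through the inverse because conjugation by \<open>y\<close> evaluates \<open>h\<close>
    and \<open>k\<close> at points \<open>?i t\<close>.\<close>
  proof (cases "p \<le> ?i p")
    case True
    \<comment> \<open>For \<open>t\<close> to the right of \<open>p\<close> also \<open>?i t\<close>
      lies to the right of \<open>p\<close>, where \<open>k\<close> is the identity. The conjugate
      of \<open>k\<close> thus keeps its support to the left of \<open>p\<close>, away from that of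
      \<open>h\<close>.\<close>
    have "(y \<otimes>\<^bsub>thompson_F\<^esub> k \<otimes>\<^bsub>thompson_F\<^esub> ?i) t = t" if t: "t \<in> {p..1}" for t
    proof (rule thompson_F_conjugate_fix[OF k y])
      show t01: "t \<in> {0..1}" using t p by simp
      then have "?i p \<le> ?i t" using thompson_F_le_iff[OF i p t01] t by simp
      with True show "k (?i t) = ?i t" using thompson_F_mem[OF i t01] by (intro k_fix) simp
    qed
    then have "a = \<one>\<^bsub>thompson_F\<^esub>"
      unfolding a_def using h k y p h_fix
      by (intro F.comm_eq_one thompson_F_disjoint_support_commute[where p = p]) auto
    then show ?thesis ..
  next
    case False
    have "(y \<otimes>\<^bsub>thompson_F\<^esub> h \<otimes>\<^bsub>thompson_F\<^esub> ?i) t = t" if t: "t \<in> {0..p}" for t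
    proof (rule thompson_F_conjugate_fix[OF h y])
      show t01: "t \<in> {0..1}" using t p by simp
      then have "?i t \<le> ?i p" using thompson_F_le_iff[OF i t01 p] t by simp
      with False show "h (?i t) = ?i t" using thompson_F_mem[OF i t01] by (intro h_fix) simp
    qed
    then have "b = \<one>\<^bsub>thompson_F\<^esub>"
      unfolding b_def using h k y p k_fix
      by (intro F.comm_eq_one thompson_F_disjoint_support_commute[where p = p, symmetric]) auto
    then show ?thesis ..
  qed
  with ab show ?thesis unfolding mixed_comm_def a_def[symmetric] b_def[symmetric] by auto
qed

section \<open>The standard generators belong to F\<close>

lemma thompson_F_memI:
  assumes ext: "f \<in> extensional {0..1}" and mono: "strict_mono_on {0..1} f"
    and cont: "continuous_on {0..1} f" and f: "f 0 = 0" "f 1 = 1" and pl: "pl_dyadic f"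
  shows "f \<in> carrier thompson_F"
proof -
  \<comment> \<open>Monotonicity and the two end values bound the image; the intermediate value
    theorem fills the interval. Injectivity comes from strict monotonicity.\<close>
  have "f ` {0..1} = {0..1}"
  proof
    show "f ` {0..1} \<subseteq> {0..1}"
      using strict_mono_on_leD[OF mono, of 0] strict_mono_on_leD[OF mono, of _ 1] f by fastforce
    show "{0..1} \<subseteq> f ` {0..1}"
    proof
      fix t :: real assume "t \<in> {0..1}"
      then show "t \<in> f ` {0..1}" using IVT'[of f 0 t 1] cont f by (auto simp: image_iff)
    qed
  qed
  then show ?thesis
    using assms by (simp add: carrier_thompson_F Bij_def bij_betw_def strict_mono_on_imp_inj_on)
qed

lemma dyadic_breakpoints: "1/2 \<in> (dyadics :: real set)" "3/4 \<in> (dyadics :: real set)"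
  "7/8 \<in> (dyadics :: real set)"
proof -
  have "of_nat 1 / 2 ^ 1 \<in> (dyadics :: real set)" "of_nat 3 / 2 ^ 2 \<in> (dyadics :: real set)"
    "of_nat 7 / 2 ^ 3 \<in> (dyadics :: real set)"
    unfolding dyadics_def by blast+
  then show "1/2 \<in> (dyadics :: real set)" "3/4 \<in> (dyadics :: real set)"
    "7/8 \<in> (dyadics :: real set)" by simp_all
qed

text \<open>The condition in \<open>pl_dyadic\<close> ranges over all pairs \<open>a\<close>,
  \<open>b\<close>, also those whose open interval is empty and so avoids every breakpoint. At a
  single point slope 1 with offset \<open>f a - a\<close> works.\<close>

lemma affine_on_singleton: "\<exists>(k::int) c. \<forall>t\<in>{a..b}. f t = 2 powi k * t + c"
  if "b \<le> a" for f :: "real \<Rightarrow> real"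
proof -
  have "{a..b} = {a} \<or> {a..b} = {}" using that by auto
  then show ?thesis by (intro exI[of _ 0] exI[of _ "f a - a"]) auto
qed

lemma thompson_x0_mem: "thompson_x0 \<in> carrier thompson_F"
proof (rule thompson_F_memI)
  show "thompson_x0 \<in> extensional {0..1}" by (simp add: thompson_x0_def)
  show "strict_mono_on {0..1} thompson_x0"
    by (auto intro!: strict_mono_onI simp: thompson_x0_def)
  \<comment> \<open>The slopes 1/2, 1, 2 increase from left to right, so the function is convex and
    equals the maximum of its affine pieces.\<close>
  have "continuous_on {0..1} (\<lambda>t::real. max (t/2) (max (t - 1/4) (2*t - 1)))"
    by (intro continuous_intros) auto
  then show "continuous_on {0..1} thompson_x0"
    by (rule continuous_on_eq) (auto simp: thompson_x0_def)
  show "pl_dyadic thompson_x0"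
  proof (rule pl_dyadicI[of "{1/2, 3/4}"])
    fix a b :: real
    assume ab: "a \<in> {0..1}" "b \<in> {0..1}" "{a<..<b} \<inter> {1/2, 3/4} = {}"
    then consider "b \<le> a" | "b \<le> 1/2" | "1/2 \<le> a" "b \<le> 3/4" | "3/4 \<le> a"
      by fastforce
    then show "\<exists>(k::int) c. \<forall>t\<in>{a..b}. thompson_x0 t = 2 powi k * t + c"
    proof cases
      case 1 then show ?thesis by (rule affine_on_singleton)
    next
      case 2 then show ?thesis using ab
        by (intro exI[of _ "-1"] exI[of _ 0]) (auto simp: thompson_x0_def power_int_minus)
    next
      case 3 then show ?thesis using ab
        by (intro exI[of _ 0] exI[of _ "-1/4"]) (auto simp: thompson_x0_def)
    next
      case 4 then show ?thesis using ab
        by (intro exI[of _ 1] exI[of _ "-1"]) (auto simp: thompson_x0_def)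
    qed
  qed (simp_all add: dyadic_breakpoints)
qed (simp_all add: thompson_x0_def)

lemma thompson_x1_mem: "thompson_x1 \<in> carrier thompson_F"
proof (rule thompson_F_memI)
  show "thompson_x1 \<in> extensional {0..1}" by (simp add: thompson_x1_def)
  show "strict_mono_on {0..1} thompson_x1"
    by (auto intro!: strict_mono_onI simp: thompson_x1_def)
  \<comment> \<open>The last three pieces form a convex function, the maximum of the three. It lies
    above the diagonal on \<open>{0..1/2}\<close> and below it on \<open>{1/2..1}\<close>, so the
    minimum with \<open>t\<close> adds the first piece.\<close>
  have "continuous_on {0..1} (\<lambda>t::real. min t (max (t/2 + 1/4) (max (t - 1/8) (2*t - 1))))"
    by (intro continuous_intros) auto
  then show "continuous_on {0..1} thompson_x1"
    by (rule continuous_on_eq) (auto simp: thompson_x1_def)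
  show "pl_dyadic thompson_x1"
  proof (rule pl_dyadicI[of "{1/2, 3/4, 7/8}"])
    fix a b :: real
    assume ab: "a \<in> {0..1}" "b \<in> {0..1}" "{a<..<b} \<inter> {1/2, 3/4, 7/8} = {}"
    then consider "b \<le> a" | "b \<le> 1/2" | "1/2 \<le> a" "b \<le> 3/4" | "3/4 \<le> a" "b \<le> 7/8" | "7/8 \<le> a"
      by fastforce
    then show "\<exists>(k::int) c. \<forall>t\<in>{a..b}. thompson_x1 t = 2 powi k * t + c"
    proof cases
      case 1 then show ?thesis by (rule affine_on_singleton)
    next
      case 2 then show ?thesis using ab
        by (intro exI[of _ 0] exI[of _ 0]) (auto simp: thompson_x1_def)
    next
      case 3 then show ?thesis using ab
        by (intro exI[of _ "-1"] exI[of _ "1/4"]) (auto simp: thompson_x1_def power_int_minus)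
    next
      case 4 then show ?thesis using ab
        by (intro exI[of _ 0] exI[of _ "-1/8"]) (auto simp: thompson_x1_def)
    next
      case 5 then show ?thesis using ab
        by (intro exI[of _ 1] exI[of _ "-1"]) (auto simp: thompson_x1_def)
    qed
  qed (simp_all add: dyadic_breakpoints)
qed (simp_all add: thompson_x1_def)

section \<open>Two nontrivial elements of F with supports on either side of 3/4\<close>

definition right_word :: "(nat \<times> bool) list"
  where "right_word = [(0, False), (1, True), (0, True)]"

definition left_word :: "(nat \<times> bool) list"
  where "left_word = [(0, True), (1, False)]"

text \<open>Bracketed to the right, as \<open>word_value\<close> unfolds
  \<open>right_word\<close>.\<close>

definition thompson_right :: "real \<Rightarrow> real"
  where "thompson_right =
    inv\<^bsub>thompson_F\<^esub> thompson_x0 \<otimes>\<^bsub>thompson_F\<^esub> (thompson_x1 \<otimes>\<^bsub>thompson_F\<^esub> thompson_x0)"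

definition thompson_left :: "real \<Rightarrow> real"
  where "thompson_left = thompson_x0 \<otimes>\<^bsub>thompson_F\<^esub> inv\<^bsub>thompson_F\<^esub> thompson_x1"

lemma thompson_right_mem [simp]: "thompson_right \<in> carrier thompson_F"
  and thompson_left_mem [simp]: "thompson_left \<in> carrier thompson_F"
  by (simp_all add: thompson_right_def thompson_left_def thompson_x0_mem thompson_x1_mem)

lemma word_value_right_word:
  "word_value thompson_F (thompson_x0 # thompson_x1 # T) right_word = thompson_right"
  and word_value_left_word:
  "word_value thompson_F (thompson_x0 # thompson_x1 # T) left_word = thompson_left"
  by (simp_all add: right_word_def left_word_def thompson_right_def thompson_left_def
      thompson_x0_mem thompson_x1_mem)

text \<open>\<open>thompson_x0\<close> maps \<open>{0..3/4}\<close> onto \<open>{0..1/2}\<close>,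
  where \<open>thompson_x1\<close> is the identity, and the conjugation undoes
  \<open>thompson_x0\<close>.\<close>

lemma thompson_right_fix:
  assumes "t \<in> {0..3/4}"
  shows "thompson_right t = t"
proof -
  have t: "t \<in> {0..1}" using assms by simp
  have "thompson_x1 (thompson_x0 t) = thompson_x0 t"
    using assms by (simp add: thompson_x0_def thompson_x1_def)
  then show ?thesis
    using t thompson_x0_mem thompson_x1_mem
    by (simp add: thompson_right_def thompson_F_mult_apply thompson_F_inv_apply)
qed

text \<open>Both generators are given by \<open>2*t - 1\<close> on \<open>{7/8..1}\<close>, which
  they map onto \<open>{3/4..1}\<close>; there the quotient of the two cancels.\<close>

lemma thompson_left_fix:
  assumes "t \<in> {3/4..1}"
  shows "thompson_left t = t"
proof -
  \<comment> \<open>The solution of \<open>2*s - 1 = t\<close>; it lies in \<open>{7/8..1}\<close>,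
    so it is the preimage of \<open>t\<close> under both generators.\<close>
  define s where "s = (t + 1) / 2"
  have s: "s \<in> {0..1}" "t \<in> {0..1}" "thompson_x1 s = t" "thompson_x0 s = t"
    using assms by (auto simp: s_def thompson_x0_def thompson_x1_def field_simps)
  have "(inv\<^bsub>thompson_F\<^esub> thompson_x1) t = s"
    using thompson_F_inv_apply(1)[OF thompson_x1_mem s(1)] s(3) by simp
  then show ?thesis
    using s thompson_x0_mem thompson_x1_mem
    by (simp add: thompson_left_def thompson_F_mult_apply)
qed

text \<open>This value distinguishes \<open>thompson_left\<close> from the identity and from
  \<open>thompson_right\<close>, both of which fix 1/2.\<close>

lemma thompson_left_half: "thompson_left (1/2) = 1/4"
proof -
  have half: "thompson_x1 (1/2) = 1/2" by (simp add: thompson_x1_def)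
  have "(inv\<^bsub>thompson_F\<^esub> thompson_x1) (1/2) = 1/2"
    using thompson_F_inv_apply(1)[OF thompson_x1_mem, of "1/2"] unfolding half by simp
  then show ?thesis
    using thompson_x0_mem thompson_x1_mem
    by (simp add: thompson_left_def thompson_F_mult_apply thompson_x0_def)
qed

lemma thompson_left_neq_one: "thompson_left \<noteq> \<one>\<^bsub>thompson_F\<^esub>"
  using thompson_left_half thompson_F_one_apply[of "1/2"] by auto

lemma thompson_right_neq_left: "thompson_right \<noteq> thompson_left"
  using thompson_left_half thompson_right_fix[of "1/2"] by auto

lemma thompson_right_neq_one: "thompson_right \<noteq> \<one>\<^bsub>thompson_F\<^esub>"
proof
  assume "thompson_right = \<one>\<^bsub>thompson_F\<^esub>"
  \<comment> \<open>A conjugate of \<open>thompson_x1\<close> is trivial only if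
    \<open>thompson_x1\<close> is, but that generator sends 3/4 to 5/8.\<close>
  then have "thompson_x1 \<otimes>\<^bsub>thompson_F\<^esub> thompson_x0 = thompson_x0"
    unfolding thompson_right_def
    using F.inv_solve_left'[of "\<one>\<^bsub>thompson_F\<^esub>" thompson_x0] thompson_x0_mem thompson_x1_mem
    by simp
  then have "thompson_x1 = \<one>\<^bsub>thompson_F\<^esub>"
    using thompson_x0_mem thompson_x1_mem by simp
  then have "thompson_x1 (3/4) = 3/4" using thompson_F_one_apply[of "3/4"] by auto
  then show False by (simp add: thompson_x1_def)
qed

section \<open>The mixed identity fails in free products\<close>

lemma free_product_mixed_comm_neq:
  fixes A :: "('a, 'm) monoid_scheme" and B :: "('b, 'n) monoid_scheme"
  assumes A: "group A" and B: "group B"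
    and h: "h \<in> carrier A" "h \<noteq> \<one>\<^bsub>A\<^esub>" and k: "k \<in> carrier A" "k \<noteq> \<one>\<^bsub>A\<^esub>" and "h \<noteq> k"
    and b: "b \<in> carrier B" "b \<noteq> \<one>\<^bsub>B\<^esub>"
  defines "P \<equiv> free_product A B"
  shows "mixed_comm P (fp_inl A h) (fp_inl A k) (fp_inr B b) \<noteq>
    mixed_comm P (fp_inl A k) (fp_inl A h) (fp_inr B b)"
proof -
  interpret A: group A by (rule A)
  interpret B: group B by (rule B)
  interpret P: group P unfolding P_def by (rule group_free_product[OF A B])
  interpret inl: group_hom A P "fp_inl A"
    by unfold_locales (simp add: P_def fp_inl_hom[OF A B])
  interpret inr: group_hom B P "fp_inr B"
    by unfold_locales (simp add: P_def fp_inr_hom[OF A B])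
  have hd_mixed_comm: "hd (mixed_comm P (fp_inl A x) (fp_inl A y) (fp_inr B b)) = Inl x"
    if x: "x \<in> carrier A" "x \<noteq> \<one>\<^bsub>A\<^esub>" and y: "y \<in> carrier A" "y \<noteq> \<one>\<^bsub>A\<^esub>" for x y
  proof -
    \<comment> \<open>With these every letter of the expanded product is nontrivial. The letters
      alternate between the two factors, also where the two commutators meet, so nothing cancels and
      the product is a reduced word of length 16 that begins with \<open>x\<close>.\<close>
    have inv_neq: "inv\<^bsub>A\<^esub> x \<noteq> \<one>\<^bsub>A\<^esub>" "inv\<^bsub>A\<^esub> y \<noteq> \<one>\<^bsub>A\<^esub>" "inv\<^bsub>B\<^esub> b \<noteq> \<one>\<^bsub>B\<^esub>"
      using x y b by (simp_all add: A.inv_eq_1_iff B.inv_eq_1_iff)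
    have "mixed_comm P (fp_inl A x) (fp_inl A y) (fp_inr B b) =
      [Inl x, Inr b, Inl y, Inr (inv\<^bsub>B\<^esub> b), Inl (inv\<^bsub>A\<^esub> x), Inr b, Inl (inv\<^bsub>A\<^esub> y), Inr (inv\<^bsub>B\<^esub> b),
       Inl y, Inr b, Inl x, Inr (inv\<^bsub>B\<^esub> b), Inl (inv\<^bsub>A\<^esub> y), Inr b, Inl (inv\<^bsub>A\<^esub> x), Inr (inv\<^bsub>B\<^esub> b)]"
      using x y b inv_neq
      by (simp add: mixed_comm_def comm_def P.inv_mult_group P.m_assoc flip: inl.hom_inv inr.hom_inv)
         (simp add: P_def free_product_def fp_inl_def fp_inr_def)
    then show ?thesis by simp
  qed
  show ?thesis
    using hd_mixed_comm[OF h k] hd_mixed_comm[OF k h] \<open>h \<noteq> k\<close> by (metis sum.inject(1))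
qed

section \<open>Limits of markings of F are not free products over F\<close>

theorem theorem4p5:
  fixes s :: nat
    and g :: "nat \<Rightarrow> (real \<Rightarrow> real) list"
    and L :: "('a, 'l) monoid_scheme" and S :: "'a list"
    and G :: "('b, 'm) monoid_scheme"
  assumes "\<And>n. length (g n) = s" and "\<And>n. set (g n) \<subseteq> carrier thompson_F"
    and "marked_group L S" and "length S = s + 2"
    and "(\<lambda>n. marked_dist thompson_F (thompson_x0 # thompson_x1 # g n) L S) \<longlonglongrightarrow> 0"
    and "group G" and "carrier G \<noteq> {\<one>\<^bsub>G\<^esub>}"
  shows "\<not> (\<exists>\<phi>\<in>iso (free_product (subgroup_generated L {S ! 0, S ! 1}) G) L.
    \<forall>x\<in>carrier (subgroup_generated L {S ! 0, S ! 1}).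
      \<phi> (fp_inl (subgroup_generated L {S ! 0, S ! 1}) x) = x)"
proof
  define A where "A = subgroup_generated L {S ! 0, S ! 1}"
  define P where "P = free_product A G"
  define T where "T n = thompson_x0 # thompson_x1 # g n" for n
  assume "\<exists>\<phi>\<in>iso (free_product (subgroup_generated L {S ! 0, S ! 1}) G) L.
    \<forall>x\<in>carrier (subgroup_generated L {S ! 0, S ! 1}).
      \<phi> (fp_inl (subgroup_generated L {S ! 0, S ! 1}) x) = x"
  then obtain \<phi> where iso: "\<phi> \<in> iso P L" and \<phi>: "\<And>x. x \<in> carrier A \<Longrightarrow> \<phi> (fp_inl A x) = x"
    by (auto simp: A_def P_def)
  have L: "group L" "set S \<subseteq> carrier L" "generate L (set S) = carrier L"
    using assms(3) by (simp_all add: marked_group_def)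
  interpret L: group L by (rule L(1))
  interpret G: group G by (rule assms(6))
  interpret A: group A unfolding A_def by (rule L.group_subgroup_generated)
  interpret P: group P
    unfolding P_def by (rule group_free_product) unfold_locales
  interpret \<phi>: group_hom P L \<phi>
    using iso by unfold_locales (simp add: iso_def)
  have inj: "inj_on \<phi> (carrier P)" using iso by (simp add: iso_def bij_betw_def)
  have inl: "fp_inl A x \<in> carrier P" if "x \<in> carrier A" for x
    using fp_inl_hom[OF A.is_group G.is_group] that by (auto simp: P_def hom_def)

  obtain b where b: "b \<in> carrier G" "b \<noteq> \<one>\<^bsub>G\<^esub>"
    using assms(7) by auto
  have inr: "fp_inr G b \<in> carrier P"
    using fp_inr_hom[OF A.is_group G.is_group] b by (auto simp: P_def hom_def)
  then have "\<phi> (fp_inr G b) \<in> generate L (set S)" by (simp add: L(3))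
  \<comment> \<open>The values of \<open>w\<close> in the marked copies of F play the part of
    \<open>y\<close> in the mixed identity, while its value in \<open>L\<close> is the image of a
    nontrivial element of \<open>G\<close>.\<close>
  from generate_word[OF L(1,2) this]
  obtain w where w: "fst ` set w \<subseteq> {..<length S}" "word_value L S w = \<phi> (fp_inr G b)" by blast

  define h k where "h = word_value L S right_word" and "k = word_value L S left_word"
  have words: "fst ` set right_word \<subseteq> {..<length S}" "fst ` set left_word \<subseteq> {..<length S}"
    by (simp_all add: right_word_def left_word_def assms(4))
  have S01: "S ! 0 \<in> carrier L" "S ! 1 \<in> carrier L"
    using L(2) assms(4) by (simp_all add: subset_iff)
  \<comment> \<open>Only the letters 0 and 1 occur in the two words, so their values stay in the
    subgroup of the first two marking elements. Since \<open>subgroup_generated\<close> intersects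
    its generators with the carrier, \<open>S01\<close> enters here.\<close>
  then have hk: "h \<in> carrier A" "k \<in> carrier A"
    by (auto simp: h_def k_def right_word_def left_word_def A_def carrier_subgroup_generated
        intro!: generate.eng generate.inv generate.one intro: generate.incl)

  have T: "length (T n) = length S" "set (T n) \<subseteq> carrier thompson_F" for n
    using assms(1,2,4) thompson_x0_mem thompson_x1_mem by (auto simp: T_def)
  \<comment> \<open>From some \<open>n\<close> on, an equation between two fixed words is true in
    \<open>T n\<close> exactly if it is true in the limit. An equation valid for every
    \<open>n\<close> is therefore valid in \<open>L\<close>, and likewise for an inequation.\<close>
  have transfer: "word_value L S u = word_value L S v"
    if "fst ` set u \<subseteq> {..<length S}" "fst ` set v \<subseteq> {..<length S}"
      "\<And>n. word_value thompson_F (T n) u = word_value thompson_F (T n) v" for u v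
    using marked_dist_tendsto_word_eq[OF assms(5)[folded T_def] T(1) group_thompson_F T(2) L(1,2) that(1,2)] that(3)
    by (auto dest: eventually_happens')
  have transfer_neq: "word_value L S u \<noteq> word_value L S v"
    if "fst ` set u \<subseteq> {..<length S}" "fst ` set v \<subseteq> {..<length S}"
      "\<And>n. word_value thompson_F (T n) u \<noteq> word_value thompson_F (T n) v" for u v
    using marked_dist_tendsto_word_eq[OF assms(5)[folded T_def] T(1) group_thompson_F T(2) L(1,2) that(1,2)] that(3)
    by (auto dest: eventually_happens')

  have T_words: "word_value thompson_F (T n) right_word = thompson_right"
    "word_value thompson_F (T n) left_word = thompson_left" for n
    by (simp_all only: T_def word_value_right_word word_value_left_word)
  \<comment> \<open>Distinctness and nontriviality are inherited from F as inequations between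
    words; the empty word stands for the neutral element.\<close>
  have "h \<noteq> k"
    using transfer_neq[OF words] by (simp add: h_def k_def T_words thompson_right_neq_left)
  moreover have "h \<noteq> \<one>\<^bsub>L\<^esub>" "k \<noteq> \<one>\<^bsub>L\<^esub>"
    using transfer_neq[OF words(1), of "[]"] transfer_neq[OF words(2), of "[]"]
    by (simp_all add: h_def k_def T_words thompson_right_neq_one thompson_left_neq_one)
  moreover have "\<one>\<^bsub>A\<^esub> = \<one>\<^bsub>L\<^esub>" by (simp add: A_def)
  ultimately have neq: "mixed_comm P (fp_inl A h) (fp_inl A k) (fp_inr G b) \<noteq>
      mixed_comm P (fp_inl A k) (fp_inl A h) (fp_inr G b)"
    unfolding P_def using hk b
    by (intro free_product_mixed_comm_neq[OF A.is_group G.is_group]) auto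

  \<comment> \<open>In each \<open>T n\<close> the word \<open>w\<close> takes some value in F,
    whichever it is, and the mixed identity with \<open>p = 3/4\<close> covers all of them.\<close>
  have "word_value L S (mixed_word right_word left_word w) =
      word_value L S (mixed_word left_word right_word w)"
  proof (rule transfer)
    fix n
    have "word_value thompson_F (T n) w \<in> carrier thompson_F"
      using w(1) by (intro word_value_closed[OF group_thompson_F T(2)]) (simp add: T(1))
    then have "mixed_comm thompson_F thompson_right thompson_left (word_value thompson_F (T n) w) =
        mixed_comm thompson_F thompson_left thompson_right (word_value thompson_F (T n) w)"
      by (intro thompson_F_mixed_identity[where p = "3/4"] thompson_right_fix thompson_left_fix)
        simp_all
    then show "word_value thompson_F (T n) (mixed_word right_word left_word w) =
      word_value thompson_F (T n) (mixed_word left_word right_word w)"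
      using words w(1)
      by (simp add: word_value_mixed_word[OF group_thompson_F T(2)] T(1) T_words)
  qed (use words w in simp_all)
  then have "mixed_comm L h k (\<phi> (fp_inr G b)) = mixed_comm L k h (\<phi> (fp_inr G b))"
    using words w by (simp add: word_value_mixed_word[OF L(1,2)] h_def k_def)
  \<comment> \<open>Since \<phi> fixes \<open>h\<close> and \<open>k\<close> along the embedding,
    the relation in \<open>L\<close> is the image of the corresponding one in \<open>P\<close>.
    Injectivity pulls it back to the free product, where it is false.\<close>
  then have "\<phi> (mixed_comm P (fp_inl A h) (fp_inl A k) (fp_inr G b)) =
      \<phi> (mixed_comm P (fp_inl A k) (fp_inl A h) (fp_inr G b))"
    using hk inl inr by (simp add: \<phi>.hom_mixed_comm \<phi>)
  with neq show False
    using inj_onD[OF inj] hk inl inr by simp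
qed

end
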